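(* (Generic charger, noiseless channel, as a deterministic Markov decision process.) In the setting of the context, assume the set $\mathcal B$ of reachable battery states is finite. For $\rho\ge0$ let $$J_\emptyset(\rho)=\sup_{\substack{\{p(x_t|x^{t-1}),\,e_t\}_{t=1}^\infty:\\(\mathbf X,\mathbf e)\in\mathcal A'_\infty\text{ a.s.}}}\liminf_{n\to\infty}\frac1n\Big(H(X^n)-\rho\sum_{t=1}^ne_t\Big),$$ the supremum being over deterministic sequences $\mathbf e=(e_t)_{t\ge1}$ in $\mathcal E$ and $\mathcal X$-valued processes $\mathbf X=(X_t)_{t\ge1}$. Then $$J_\emptyset(\rho)=\sup_{\{e_t\}_{t=1}^\infty}\liminf_{n\to\infty}\frac1n\Big(\log(\mathbf N_n\cdot\mathbf 1)-\rho\sum_{t=1}^ne_t\Big),$$ where $\mathbf N_t=\mathbf N_{t-1}\cdot\mathbf A_{e_t}$, and $J_\emptyset(\rho)$ is the optimal infinite-horizon average reward of the following deterministic Markov decision process: the state is $\mathbf s_t=\dfrac{\mathbf N_{t-1}}{\mathbf N_{t-1}\cdot\mathbf 1}$, a row vector in the probability simplex in $\mathbb R^{|\mathcal B|}$, with initial state $\mathbf s_1=\mathbf N_0$ the unit mass at $b=\bar B$; the action is $e_t\in\mathcal E$; the state evolves as $\mathbf s_{t+1}=\dfrac{\mathbf s_t\mathbf A_{e_t}}{\mathbf s_t\mathbf A_{e_t}\mathbf 1}$; and the reward is $g(\mathbf s,e)=\log(\mathbf s\mathbf A_e\mathbf 1)-\rho e$. That is, $$J_\emptyset(\rho)=\sup_{\{e_t\}_{t=1}^\infty}\liminf_{n\to\infty}\frac1n\sum_{t=1}^n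 g(\mathbf s_t,e_t).$$
   Context: $\mathcal X$ and $\mathcal E$ are finite; $\phi:\mathcal X\to[0,\infty)$; $\bar B$ is the battery capacity; $\mathcal E\subseteq[0,\bar B]$ contains a strictly positive element; $\phi(x)\le\bar B$ for all $x\in\mathcal X$; there is $0\in\mathcal X$ with $\phi(0)=0$. $H$ is Shannon entropy, logarithms to base 2. $\mathcal A'_n$ is the set of pairs $(x^n,e^n)\in\mathcal X^n\times\mathcal E^n$ such that, with $b_1=\bar B$ and $b_{t+1}=\min\{b_t+e_t,\bar B\}-\phi(x_t)$, one has $\phi(x_t)\le\min\{b_t+e_t,\bar B\}$ for $t=1,\dots,n$. For infinite sequences, $(\mathbf x,\mathbf e)\in\mathcal A'_\infty$ means $(x^n,e^n)\in\mathcal A'_n$ for every $n\ge1$. $\mathcal B$ is the set of all battery levels that can be reached from $b_1=\bar B$ by some finite feasible pair $(x^n,e^n)\in\mathcal A'_n$. For a fixed energy sequence $e^n$ and $b\in\mathcal B$, $N_n(b)$ is the number of sequences $x^n$ for which $(x^n,e^n)\in\mathcal A'_n$ and $b_{n+1}=b$; $\mathbf N_n=[N_n(b):b\in\mathcal B]$ is the corresponding $|\mathcal B|$-dimensional row vector, and $\mathbf N_0$ is by convention the row vector with entry $1$ at $b=\bar B$ and $0$ elsewhere. For $e\in\mathcal E$, $G_e$ is the labeled directed graph with vertex set $\mathcal B$ in which there is an edge labeled $x$ from $b$ to $b'$ if $x\in\mathcal X$ and $b'=\min\{b+e,\bar B\}-\phi(x)$. $\mathbf A_e$ is the $|\mathcal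 B|\times|\mathcal B|$ adjacency matrix of $G_e$, defined by $(A_e)_{b,b'}=1$ if there is an edge going from $b$ into $b'$ and $(A_e)_{b,b'}=0$ otherwise. $\mathbf 1$ is the all-ones column vector of dimension $|\mathcal B|$.
   Formalization: If two symbols have equal cost, the recursion with the 0/1 matrix A_e is false (it merges parallel edges). The theorem instead takes (A_e)_{b,b'} to be the number of edges from b to b', for every φ; the 0/1 matrix is kept when φ is injective. *)

theory Defs
  imports "HOL-Probability.Probability"
begin

(* Time is shifted by one: index t stands for time t + 1, so x t is x_(t+1), e t is e_(t+1) and
   battery c phi x e t is b_(t+1).  A word x^n is an element of {..<n} \<rightarrow>\<^sub>E UNIV; a function on all of nat
   is an infinite sequence, of which the notions indexed by n only see the first n entries.
   Throughout, c is the battery capacity and E the set of energy arrivals. *)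

fun battery :: "real \<Rightarrow> ('x \<Rightarrow> real) \<Rightarrow> (nat \<Rightarrow> 'x) \<Rightarrow> (nat \<Rightarrow> real) \<Rightarrow> nat \<Rightarrow> real" where
  "battery c \<phi> x e 0 = c"
| "battery c \<phi> x e (Suc t) = min (battery c \<phi> x e t + e t) c - \<phi> (x t)"

definition feasible ::
    "real \<Rightarrow> ('x \<Rightarrow> real) \<Rightarrow> real set \<Rightarrow> nat \<Rightarrow> (nat \<Rightarrow> 'x) \<Rightarrow> (nat \<Rightarrow> real) \<Rightarrow> bool" where
  "feasible c \<phi> E n x e \<longleftrightarrow>
     (\<forall>t<n. e t \<in> E \<and> \<phi> (x t) \<le> min (battery c \<phi> x e t + e t) c)"

definition feasible_inf ::
    "real \<Rightarrow> ('x \<Rightarrow> real) \<Rightarrow> real set \<Rightarrow> (nat \<Rightarrow> 'x) \<Rightarrow> (nat \<Rightarrow> real) \<Rightarrow> bool" where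
  "feasible_inf c \<phi> E x e \<longleftrightarrow> (\<forall>n\<ge>1. feasible c \<phi> E n x e)"

definition levels :: "real \<Rightarrow> ('x \<Rightarrow> real) \<Rightarrow> real set \<Rightarrow> real set" where
  "levels c \<phi> E = {battery c \<phi> x e n | x e n. feasible c \<phi> E n x e}"

definition energy_seqs :: "real set \<Rightarrow> (nat \<Rightarrow> real) set" where
  "energy_seqs E = (UNIV :: nat set) \<rightarrow> E"

(* A process X_1, X_2, ... is given by its law on path space, i.e. by the measure that the
   conditional distributions p(x_t | x^(t-1)) determine. *)
definition path_space :: "(nat \<Rightarrow> 'x) measure" where
  "path_space = Pi\<^sub>M (UNIV :: nat set) (\<lambda>_. count_space (UNIV :: 'x set))"

definition admissible ::
    "real \<Rightarrow> ('x \<Rightarrow> real) \<Rightarrow> real set \<Rightarrow> ((nat \<Rightarrow> 'x) measure \<times> (nat \<Rightarrow> real)) set" where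
  "admissible c \<phi> E =
     {(P, e). e \<in> energy_seqs E \<and> prob_space P \<and> sets P = sets path_space \<and>
              (AE x in P. feasible_inf c \<phi> E x e)}"

definition block_entropy :: "(nat \<Rightarrow> 'x) measure \<Rightarrow> nat \<Rightarrow> real" where
  "block_entropy P n =
     prob_space.entropy P 2 (count_space ((\<lambda>x. restrict x {..<n}) ` space P)) (\<lambda>x. restrict x {..<n})"

definition J_empty :: "real \<Rightarrow> ('x \<Rightarrow> real) \<Rightarrow> real set \<Rightarrow> real \<Rightarrow> ereal" where
  "J_empty c \<phi> E \<rho> =
     (SUP (P, e) \<in> admissible c \<phi> E.
        liminf (\<lambda>n. ereal (1 / real n * (block_entropy P n - \<rho> * (\<Sum>t<n. e t)))))"

(* Row vectors indexed by the finite set B are functions real \<Rightarrow> real, matrices are functions of two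
   real arguments; only the entries with indices in B matter. *)
definition total :: "real set \<Rightarrow> (real \<Rightarrow> real) \<Rightarrow> real" where
  "total B v = (\<Sum>b\<in>B. v b)"

definition vec_mat :: "real set \<Rightarrow> (real \<Rightarrow> real) \<Rightarrow> (real \<Rightarrow> real \<Rightarrow> real) \<Rightarrow> real \<Rightarrow> real" where
  "vec_mat B v M = (\<lambda>b'. \<Sum>b\<in>B. v b * M b b')"

definition simplex_vectors :: "real set \<Rightarrow> (real \<Rightarrow> real) set" where
  "simplex_vectors B = {s. (\<forall>b\<in>B. 0 \<le> s b) \<and> (\<forall>b. b \<notin> B \<longrightarrow> s b = 0) \<and> total B s = 1}"

definition unit_mass :: "real \<Rightarrow> real \<Rightarrow> real" where
  "unit_mass c = (\<lambda>b. if b = c then 1 else 0)"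

definition num_words ::
    "real \<Rightarrow> ('x \<Rightarrow> real) \<Rightarrow> real set \<Rightarrow> (nat \<Rightarrow> real) \<Rightarrow> nat \<Rightarrow> real \<Rightarrow> real" where
  "num_words c \<phi> E e n b =
     real (card {x \<in> {..<n} \<rightarrow>\<^sub>E UNIV. feasible c \<phi> E n x e \<and> battery c \<phi> x e n = b})"

definition graph_edges :: "real \<Rightarrow> ('x \<Rightarrow> real) \<Rightarrow> real set \<Rightarrow> real \<Rightarrow> (real \<times> 'x \<times> real) set" where
  "graph_edges c \<phi> E e =
     {(b, x, b'). b \<in> levels c \<phi> E \<and> b' \<in> levels c \<phi> E \<and> b' = min (b + e) c - \<phi> x}"

definition adjacency :: "real \<Rightarrow> ('x \<Rightarrow> real) \<Rightarrow> real set \<Rightarrow> real \<Rightarrow> real \<Rightarrow> real \<Rightarrow> real" where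
  "adjacency c \<phi> E e b b' = (if \<exists>x. (b, x, b') \<in> graph_edges c \<phi> E e then 1 else 0)"

(* Symbols x of equal cost give parallel edges, which the 0/1 matrix identifies.  Words are then no
   longer counted by products of 0/1 matrices, only by products of edge-count matrices.  The two
   matrices agree exactly when phi is injective. *)
definition multi_adjacency :: "real \<Rightarrow> ('x \<Rightarrow> real) \<Rightarrow> real set \<Rightarrow> real \<Rightarrow> real \<Rightarrow> real \<Rightarrow> real" where
  "multi_adjacency c \<phi> E e b b' = real (card {x. (b, x, b') \<in> graph_edges c \<phi> E e})"

fun dmdp_state :: "('s \<Rightarrow> 'a \<Rightarrow> 's) \<Rightarrow> 's \<Rightarrow> (nat \<Rightarrow> 'a) \<Rightarrow> nat \<Rightarrow> 's" where
  "dmdp_state f s a 0 = s"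
| "dmdp_state f s a (Suc t) = f (dmdp_state f s a t) (a t)"

definition dmdp_optimal_reward ::
    "'a set \<Rightarrow> ('s \<Rightarrow> 'a \<Rightarrow> 's) \<Rightarrow> ('s \<Rightarrow> 'a \<Rightarrow> real) \<Rightarrow> 's \<Rightarrow> ereal" where
  "dmdp_optimal_reward Act f g s =
     (SUP a \<in> (UNIV :: nat set) \<rightarrow> Act.
        liminf (\<lambda>n. ereal (1 / real n * (\<Sum>t<n. g (dmdp_state f s a t) (a t)))))"

definition transition ::
    "real set \<Rightarrow> (real \<Rightarrow> real \<Rightarrow> real \<Rightarrow> real) \<Rightarrow> (real \<Rightarrow> real) \<Rightarrow> real \<Rightarrow> (real \<Rightarrow> real)" where
  "transition B A s e = (\<lambda>b. vec_mat B s (A e) b / total B (vec_mat B s (A e)))"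

definition reward ::
    "real set \<Rightarrow> (real \<Rightarrow> real \<Rightarrow> real \<Rightarrow> real) \<Rightarrow> real \<Rightarrow> (real \<Rightarrow> real) \<Rightarrow> real \<Rightarrow> real" where
  "reward B A \<rho> s e = log 2 (total B (vec_mat B s (A e))) - \<rho> * e"

end

(* The uniform law on feasible n-words maximizes H(X^n) for one n, but these laws are not consistent
   in n, so a given energy sequence e need not itself be optimal for the sup over processes.  Instead,
   cut e after m steps, where m is such that, for the number N_m of feasible m-words,
   (log N_m - rho * (e_1 + ... + e_m)) / m is close to its limit inferior or above, append a bounded
   number K of steps that send the free symbol and harvest a positive amount of energy, which fills
   the battery, and repeat.  Sending independent uniform feasible m-words in the blocks gives every
   n-prefix probability at most (N_m)^-(n div (m + K)), hence H(X^n) at least (n div (m + K)) log N_m;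
   the loss due to K vanishes as m grows. *)
theory Submission
  imports Defs
begin

subsection \<open>Battery dynamics and word counts\<close>

lemma battery_cong:
  assumes "\<And>i. i < t \<Longrightarrow> x i = x' i" "\<And>i. i < t \<Longrightarrow> e i = e' i"
  shows "battery c \<phi> x e t = battery c \<phi> x' e' t"
  using assms by (induction t) auto

lemma feasible_cong:
  assumes "\<And>i. i < n \<Longrightarrow> x i = x' i" "\<And>i. i < n \<Longrightarrow> e i = e' i"
  shows "feasible c \<phi> E n x e \<longleftrightarrow> feasible c \<phi> E n x' e'"
proof -
  have "battery c \<phi> x e t = battery c \<phi> x' e' t" if "t < n" for t
    using assms that by (intro battery_cong) auto
  then show ?thesis
    using assms unfolding feasible_def by auto
qed

lemma feasible_mono: "feasible c \<phi> E n x e \<Longrightarrow> m \<le> n \<Longrightarrow> feasible c \<phi> E m x e"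
  unfolding feasible_def by auto

lemma feasible_Suc:
  "feasible c \<phi> E (Suc n) x e \<longleftrightarrow>
     feasible c \<phi> E n x e \<and> e n \<in> E \<and> \<phi> (x n) \<le> min (battery c \<phi> x e n + e n) c"
  unfolding feasible_def by (auto simp: less_Suc_eq)

lemma feasible_inf_iff: "feasible_inf c \<phi> E x e \<longleftrightarrow> (\<forall>n. feasible c \<phi> E n x e)"
  unfolding feasible_inf_def by (metis feasible_mono le_Suc_eq less_eq_nat.simps(1) nat_le_linear One_nat_def)

text \<open>The initial level is \<open>c\<close>, so a full battery erases the past: from such a
  time on, the dynamics start afresh. This makes concatenation of blocks possible.\<close>

lemma battery_add:
  assumes "battery c \<phi> x e t = c"
  shows "battery c \<phi> x e (t + s) = battery c \<phi> (\<lambda>i. x (t + i)) (\<lambda>i. e (t + i)) s"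
  using assms by (induction s) auto

lemma feasible_add:
  assumes "feasible c \<phi> E t x e" "battery c \<phi> x e t = c"
    and s: "feasible c \<phi> E s (\<lambda>i. x (t + i)) (\<lambda>i. e (t + i))"
  shows "feasible c \<phi> E (t + s) x e"
  using s
proof (induction s)
  case (Suc s)
  then show ?case
    using battery_add[OF assms(2), of s] by (auto simp: feasible_Suc)
qed (use assms in auto)

definition feasible_words ::
    "real \<Rightarrow> ('x \<Rightarrow> real) \<Rightarrow> real set \<Rightarrow> (nat \<Rightarrow> real) \<Rightarrow> nat \<Rightarrow> (nat \<Rightarrow> 'x) set" where
  "feasible_words c \<phi> E e n = {x \<in> {..<n} \<rightarrow>\<^sub>E UNIV. feasible c \<phi> E n x e}"

lemma finite_feasible_words [simp]: "finite (feasible_words c \<phi> E e n :: (nat \<Rightarrow> 'x::finite) set)"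
proof -
  have "finite ({..<n} \<rightarrow>\<^sub>E (UNIV :: 'x set))"
    by (intro finite_PiE) auto
  then show ?thesis
    unfolding feasible_words_def by simp
qed

section \<open>Reachable levels and the transfer-matrix recursion for word counts\<close>

locale energy_harvesting =
  fixes \<phi> :: "'x::finite \<Rightarrow> real" and x0 :: 'x and E :: "real set" and c :: real
  assumes cost: "0 \<le> \<phi> x" "\<phi> x \<le> c"
    and zero_cost: "\<phi> x0 = 0"
    and E_nonneg: "e \<in> E \<Longrightarrow> 0 \<le> e"
    and pos_arrival: "\<exists>e\<in>E. 0 < e"
    and finite_levels: "finite (levels c \<phi> E)"
begin

abbreviation "B \<equiv> levels c \<phi> E"
abbreviation "N \<equiv> num_words c \<phi> E"
abbreviation "M \<equiv> multi_adjacency c \<phi> E"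
abbreviation "W \<equiv> feasible_words c \<phi> E"

lemma capacity_nonneg: "0 \<le> c"
  using cost[of x0] by simp

text \<open>The condition on the last step says precisely that the level left after it is
  nonnegative; at \<open>n = 0\<close> the level is the capacity.\<close>

lemma battery_nonneg: "feasible c \<phi> E n x e \<Longrightarrow> 0 \<le> battery c \<phi> x e n"
  by (cases n) (auto simp: feasible_def capacity_nonneg)

lemma battery_le: "battery c \<phi> x e n \<le> c"
  using cost(1)[of "x (n - 1)"] by (cases n) auto

lemma battery_in_levels: "feasible c \<phi> E n x e \<Longrightarrow> battery c \<phi> x e n \<in> B"
  unfolding levels_def by blast

lemma capacity_in_levels: "c \<in> B"
  using battery_in_levels[of 0] by (simp add: feasible_def)

lemma levels_nonneg: "b \<in> B \<Longrightarrow> 0 \<le> b"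
  unfolding levels_def using battery_nonneg by auto

text \<open>A path reaching \<open>b\<close> can be prolonged by \<open>x\<close> and
  \<open>e\<close>, since overwriting entry \<open>n\<close> leaves its first \<open>n\<close> steps
  as they were.\<close>

lemma levels_step:
  assumes "b \<in> B" "e \<in> E" "\<phi> x \<le> min (b + e) c"
  shows "min (b + e) c - \<phi> x \<in> B"
proof -
  obtain y a n where y: "b = battery c \<phi> y a n" "feasible c \<phi> E n y a"
    using assms(1) unfolding levels_def by auto
  define y' where "y' = y(n := x)"
  define a' where "a' = a(n := e)"
  have "battery c \<phi> y' a' n = b"
    unfolding y by (rule battery_cong) (auto simp: y'_def a'_def)
  moreover have "feasible c \<phi> E n y' a'"
    using y(2) by (subst feasible_cong[of n y' y a' a]) (auto simp: y'_def a'_def)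
  ultimately have "feasible c \<phi> E (Suc n) y' a'" "battery c \<phi> y' a' (Suc n) = min (b + e) c - \<phi> x"
    using assms by (auto simp: feasible_Suc y'_def a'_def)
  then show ?thesis
    using battery_in_levels by metis
qed

lemma feasible_zero: "e \<in> energy_seqs E \<Longrightarrow> feasible c \<phi> E n (\<lambda>_. x0) e"
proof (induction n)
  case (Suc n)
  then have "feasible c \<phi> E n (\<lambda>_. x0) e" "e n \<in> E"
    by (auto simp: energy_seqs_def)
  then show ?case
    using battery_nonneg[of n "\<lambda>_. x0" e] capacity_nonneg E_nonneg[of "e n"] zero_cost
    by (simp add: feasible_Suc)
qed (simp add: feasible_def)

text \<open>The word of free symbols is always affordable, so the logarithms, normalizations and
  uniform laws built from word counts make sense.\<close>

lemma feasible_words_nonempty: "e \<in> energy_seqs E \<Longrightarrow> W e n \<noteq> {}"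
proof -
  assume "e \<in> energy_seqs E"
  then have "feasible c \<phi> E n (restrict (\<lambda>_. x0) {..<n}) e"
    using feasible_zero by (subst feasible_cong[of n _ "\<lambda>_. x0" e e]) auto
  then have "restrict (\<lambda>_. x0) {..<n} \<in> W e n"
    by (auto simp: feasible_words_def)
  then show ?thesis by auto
qed

lemma total_num_words: "total B (N e n) = real (card (W e n))"
proof -
  have "card (W e n) = card (\<Union>b\<in>B. {x \<in> W e n. battery c \<phi> x e n = b})"
    by (rule arg_cong[of _ _ card]) (auto simp: feasible_words_def battery_in_levels)
  also have "\<dots> = (\<Sum>b\<in>B. card {x \<in> W e n. battery c \<phi> x e n = b})"
    using finite_levels by (intro card_UN_disjoint) auto
  finally show ?thesis
    by (simp add: total_def num_words_def feasible_words_def conj_assoc)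
qed

lemma total_num_words_pos: "e \<in> energy_seqs E \<Longrightarrow> 0 < total B (N e n)"
  using feasible_words_nonempty by (simp add: total_num_words card_gt_0_iff)

lemma num_words_0: "N e 0 = unit_mass c"
proof
  fix b
  have "{x \<in> {..<0} \<rightarrow>\<^sub>E UNIV. feasible c \<phi> E 0 x e \<and> battery c \<phi> x e 0 = b} =
      (if b = c then {\<lambda>_. undefined} else {})"
    by (auto simp: feasible_def)
  then show "N e 0 b = unit_mass c b"
    by (simp add: num_words_def unit_mass_def)
qed

text \<open>Splitting off the last symbol turns a word ending at \<open>b'\<close> into an
  intermediate level \<open>b\<close>, a shorter word ending at \<open>b\<close>, and the label of
  an edge from \<open>b\<close> to \<open>b'\<close>. Labels count with multiplicity, hence the
  edge-count matrix.\<close>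

lemma num_words_Suc:
  assumes e: "e \<in> energy_seqs E"
  shows "N e (Suc n) = vec_mat B (N e n) (M (e n))"
proof
  fix b'
  let ?L = "\<lambda>n b. {x \<in> {..<n} \<rightarrow>\<^sub>E UNIV. feasible c \<phi> E n x e \<and> battery c \<phi> x e n = b}"
  let ?G = "\<lambda>b. {x. (b, x, b') \<in> graph_edges c \<phi> E (e n)}"
  have eE: "e n \<in> E" using e by (auto simp: energy_seqs_def)
  have fin: "finite (?L n b)" for b
    by (rule finite_subset[OF _ finite_feasible_words[of c \<phi> E e n]]) (auto simp: feasible_words_def)
  have "bij_betw (\<lambda>(b, w, x). w(n := x)) (SIGMA b:B. ?L n b \<times> ?G b) (?L (Suc n) b')"
  proof (rule bij_betw_byWitness[where f' = "\<lambda>y. (battery c \<phi> y e n, restrict y {..<n}, y n)"])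
    have r: "w(n := x) \<in> {..<Suc n} \<rightarrow>\<^sub>E UNIV" "restrict (w(n := x)) {..<n} = w"
      "battery c \<phi> (w(n := x)) e n = battery c \<phi> w e n"
      "feasible c \<phi> E n (w(n := x)) e = feasible c \<phi> E n w e"
      if "w \<in> {..<n} \<rightarrow>\<^sub>E UNIV" for w :: "nat \<Rightarrow> 'x" and x
      using that
      by (auto simp: PiE_def extensional_def restrict_def fun_eq_iff
            intro!: battery_cong feasible_cong)
    have q: "battery c \<phi> (restrict y {..<n}) e n = battery c \<phi> y e n"
      "feasible c \<phi> E n (restrict y {..<n}) e = feasible c \<phi> E n y e" for y
      by (auto intro!: battery_cong feasible_cong)
    show "\<forall>p\<in>(SIGMA b:B. ?L n b \<times> ?G b).
        (\<lambda>y. (battery c \<phi> y e n, restrict y {..<n}, y n)) ((\<lambda>(b, w, x). w(n := x)) p) = p"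
      using r by auto
    show "\<forall>y\<in>?L (Suc n) b'.
        (\<lambda>(b, w, x). w(n := x)) (battery c \<phi> y e n, restrict y {..<n}, y n) = y"
      by (auto simp: PiE_def extensional_def restrict_def fun_eq_iff)
    show "(\<lambda>(b, w, x). w(n := x)) ` (SIGMA b:B. ?L n b \<times> ?G b) \<subseteq> ?L (Suc n) b'"
    proof (rule image_subsetI)
      fix p assume "p \<in> (SIGMA b:B. ?L n b \<times> ?G b)"
      then obtain b w x where p: "p = (b, w, x)" and w: "w \<in> {..<n} \<rightarrow>\<^sub>E UNIV" "feasible c \<phi> E n w e"
        and b: "battery c \<phi> w e n = b" and g: "(b, x, b') \<in> graph_edges c \<phi> E (e n)"
        by blast
      \<comment> \<open>The edge relation does not mention affordability. It follows from
        \<open>b' \<in> B\<close>: reachable levels are nonnegative, so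
        \<open>\<phi> x \<le> min (b + e n) c\<close>.\<close>
      have b': "b' = min (b + e n) c - \<phi> x" "0 \<le> b'"
        using g levels_nonneg[of b'] by (auto simp: graph_edges_def)
      then have "feasible c \<phi> E (Suc n) (w(n := x)) e" "battery c \<phi> (w(n := x)) e (Suc n) = b'"
        using r[OF w(1), of x] w(2) eE b by (auto simp: feasible_Suc)
      then show "(\<lambda>(b, w, x). w(n := x)) p \<in> ?L (Suc n) b'"
        unfolding p prod.case mem_Collect_eq using r(1)[OF w(1)] by blast
    qed
    show "(\<lambda>y. (battery c \<phi> y e n, restrict y {..<n}, y n)) ` ?L (Suc n) b'
        \<subseteq> (SIGMA b:B. ?L n b \<times> ?G b)"
    proof (rule image_subsetI)
      fix y assume "y \<in> ?L (Suc n) b'"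
      then have y: "feasible c \<phi> E (Suc n) y e" "b' = battery c \<phi> y e (Suc n)"
        by auto
      then have f: "feasible c \<phi> E n y e"
        by (simp add: feasible_Suc)
      have "b' \<in> B"
        using battery_in_levels[OF y(1)] y(2) by simp
      then have "(battery c \<phi> y e n, y n, b') \<in> graph_edges c \<phi> E (e n)"
        using battery_in_levels[OF f] y(2) by (simp add: graph_edges_def)
      then show "(battery c \<phi> y e n, restrict y {..<n}, y n) \<in> (SIGMA b:B. ?L n b \<times> ?G b)"
        using battery_in_levels[OF f] q[of y] f by simp
    qed
  qed
  then have "card (?L (Suc n) b') = card (SIGMA b:B. ?L n b \<times> ?G b)"
    by (rule bij_betw_same_card[symmetric])
  also have "\<dots> = (\<Sum>b\<in>B. card (?L n b) * card (?G b))"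
    using finite_levels fin by (simp add: card_SigmaI card_cartesian_product)
  finally show "N e (Suc n) b' = vec_mat B (N e n) (M (e n)) b'"
    by (simp add: num_words_def vec_mat_def multi_adjacency_def)
qed

text \<open>The endpoints of an edge fix the cost of its label, and an injective cost fixes the
  label, so each edge count is 0 or 1.\<close>

lemma adjacency_inj:
  assumes "inj \<phi>"
  shows "adjacency c \<phi> E = M"
proof (intro ext)
  fix e b b'
  have "x = y" if "(b, x, b') \<in> graph_edges c \<phi> E e" "(b, y, b') \<in> graph_edges c \<phi> E e" for x y
    using that injD[OF assms, of x y] by (auto simp: graph_edges_def)
  then have "{x. (b, x, b') \<in> graph_edges c \<phi> E e} = {} \<or>
      (\<exists>x. {x. (b, x, b') \<in> graph_edges c \<phi> E e} = {x})"
    by blast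
  then show "adjacency c \<phi> E e b b' = M e b b'"
    unfolding adjacency_def multi_adjacency_def by fastforce
qed

section \<open>Normalized word counts as states of a decision process\<close>

lemma total_vec_mat_ge:
  assumes s: "s \<in> simplex_vectors B" and e: "e \<in> E"
  shows "1 \<le> total B (vec_mat B s (M e))"
proof -
  \<comment> \<open>The free symbol supplies an edge from \<open>b\<close> to
    \<open>min (b + e) c\<close>, so every row sum is at least 1. The total to be bounded is the
    average of the row sums with weights \<open>s\<close>.\<close>
  have row: "1 \<le> (\<Sum>b'\<in>B. M e b b')" if b: "b \<in> B" for b
  proof -
    have b1: "min (b + e) c \<in> B"
      using levels_step[OF b e, of x0] zero_cost levels_nonneg[OF b] E_nonneg[OF e] capacity_nonneg
      by simp
    then have "x0 \<in> {x. (b, x, min (b + e) c) \<in> graph_edges c \<phi> E e}"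
      using b zero_cost by (simp add: graph_edges_def)
    then have "1 \<le> card {x. (b, x, min (b + e) c) \<in> graph_edges c \<phi> E e}"
      by (metis One_nat_def Suc_leI card_gt_0_iff empty_iff finite)
    then have "1 \<le> M e b (min (b + e) c)"
      by (simp add: multi_adjacency_def)
    also have "\<dots> \<le> (\<Sum>b'\<in>B. M e b b')"
      using b1 finite_levels by (intro member_le_sum) (auto simp: multi_adjacency_def)
    finally show ?thesis .
  qed
  have "1 = (\<Sum>b\<in>B. s b * 1)"
    using s by (simp add: simplex_vectors_def total_def)
  also have "\<dots> \<le> (\<Sum>b\<in>B. s b * (\<Sum>b'\<in>B. M e b b'))"
    using s row by (intro sum_mono mult_left_mono) (auto simp: simplex_vectors_def)
  also have "\<dots> = total B (vec_mat B s (M e))"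
    unfolding total_def vec_mat_def by (subst sum.swap) (simp add: sum_distrib_left)
  finally show ?thesis .
qed

lemma unit_mass_simplex: "unit_mass c \<in> simplex_vectors B"
  using capacity_in_levels finite_levels
  by (auto simp: simplex_vectors_def unit_mass_def total_def)

lemma transition_simplex:
  assumes s: "s \<in> simplex_vectors B" and e: "e \<in> E"
  shows "transition B M s e \<in> simplex_vectors B"
proof -
  have pos: "0 < total B (vec_mat B s (M e))"
    using total_vec_mat_ge[OF s e] by simp
  \<comment> \<open>Simplex vectors must vanish off \<open>B\<close>; the new vector does because
    every edge ends in \<open>B\<close>.\<close>
  have "M e b b' = 0" if "b' \<notin> B" for b b'
    using that by (simp add: multi_adjacency_def graph_edges_def)
  then have "vec_mat B s (M e) b' = 0" if "b' \<notin> B" for b'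
    using that by (simp add: vec_mat_def)
  moreover have "0 \<le> vec_mat B s (M e) b'" for b'
    using s by (auto simp: vec_mat_def multi_adjacency_def simplex_vectors_def intro!: sum_nonneg)
  moreover have "total B (transition B M s e) = 1"
    using pos by (simp add: total_def transition_def flip: sum_divide_distrib)
  ultimately show ?thesis
    using pos by (auto simp: simplex_vectors_def transition_def)
qed

lemma vec_mat_scale: "vec_mat B (\<lambda>b. v b / r) A = (\<lambda>b. vec_mat B v A b / r)"
  by (simp add: vec_mat_def sum_divide_distrib)

lemma total_scale: "total B (\<lambda>b. v b / r) = total B v / r"
  by (simp add: total_def sum_divide_distrib)

text \<open>Before normalization the step is linear, so the factor
  \<open>1 / total B (N e t)\<close> in the current state cancels when the next state is
  normalized.\<close>

lemma dmdp_state_eq: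
  assumes e: "e \<in> energy_seqs E"
  shows "dmdp_state (transition B M) (unit_mass c) e t = (\<lambda>b. N e t b / total B (N e t))"
proof (induction t)
  case 0
  have "total B (unit_mass c) = 1"
    using unit_mass_simplex by (simp add: simplex_vectors_def)
  then show ?case by (simp add: num_words_0)
next
  case (Suc t)
  have "total B (N e t) > 0"
    by (rule total_num_words_pos[OF e])
  moreover have "transition B M (\<lambda>b. N e t b / total B (N e t)) (e t) =
      (\<lambda>b. N e (Suc t) b / total B (N e t) / (total B (N e (Suc t)) / total B (N e t)))"
    by (simp only: transition_def vec_mat_scale total_scale flip: num_words_Suc[OF e])
  ultimately show ?case
    by (simp add: Suc.IH)
qed

text \<open>Each reward is the increment of \<open>log 2 (total B (N e n))\<close> minus the energy
  cost, so the sum telescopes, starting from the logarithm of 1.\<close>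

lemma sum_reward:
  assumes e: "e \<in> energy_seqs E"
  shows "(\<Sum>t<n. reward B M \<rho> (dmdp_state (transition B M) (unit_mass c) e t) (e t)) =
    log 2 (total B (N e n)) - \<rho> * (\<Sum>t<n. e t)"
proof (induction n)
  case 0
  then show ?case
    using unit_mass_simplex by (simp add: num_words_0 simplex_vectors_def)
next
  case (Suc n)
  have "reward B M \<rho> (dmdp_state (transition B M) (unit_mass c) e n) (e n) =
      log 2 (total B (N e (Suc n)) / total B (N e n)) - \<rho> * e n"
    by (simp add: reward_def dmdp_state_eq[OF e] vec_mat_scale total_scale num_words_Suc[OF e])
  also have "\<dots> = log 2 (total B (N e (Suc n))) - log 2 (total B (N e n)) - \<rho> * e n"
    using total_num_words_pos[OF e, of n] total_num_words_pos[OF e, of "Suc n"]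
    by (simp add: log_divide)
  finally show ?case
    using Suc by (simp add: algebra_simps)
qed

lemma dmdp_optimal_reward_eq:
  "dmdp_optimal_reward E (transition B M) (reward B M \<rho>) (unit_mass c) =
     (SUP e \<in> energy_seqs E.
        liminf (\<lambda>n. ereal (1 / real n * (log 2 (total B (N e n)) - \<rho> * (\<Sum>t<n. e t)))))"
  unfolding dmdp_optimal_reward_def energy_seqs_def[symmetric] by (simp add: sum_reward)

end

subsection \<open>Block entropies on path space\<close>

lemma space_path_space [simp]: "space path_space = UNIV"
  by (auto simp: path_space_def space_PiM PiE_def)

lemma prefix_eq_event [measurable]:
  "{x :: nat \<Rightarrow> 'x. restrict x {..<n} = a} \<in> sets path_space"
proof (cases "a \<in> extensional {..<n}")
  case True
  then have "{x :: nat \<Rightarrow> 'x. restrict x {..<n} = a} = {x \<in> space path_space. \<forall>i\<in>{..<n}. x i = a i}"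
    by (auto simp: fun_eq_iff extensional_def)
  also have "\<dots> \<in> sets path_space"
    unfolding path_space_def by measurable
  finally show ?thesis .
next
  case False
  then have "{x :: nat \<Rightarrow> 'x. restrict x {..<n} = a} = {}"
    by auto
  then show ?thesis by simp
qed

lemma finite_prefixes: "finite (range (\<lambda>x :: nat \<Rightarrow> 'x::finite. restrict x {..<n}))"
proof (rule finite_subset)
  show "range (\<lambda>x. restrict x {..<n}) \<subseteq> {..<n} \<rightarrow>\<^sub>E (UNIV :: 'x set)"
    by (auto simp: PiE_def)
qed (auto intro: finite_PiE)

text \<open>Feasibility up to \<open>n\<close> reads only the first \<open>n\<close> symbols, and
  there are finitely many prefixes, so the event is a finite union of prefix events.\<close>

lemma feasible_event: "{x :: nat \<Rightarrow> 'x::finite. feasible c \<phi> E n x e} \<in> sets path_space"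
proof -
  let ?r = "\<lambda>x :: nat \<Rightarrow> 'x. restrict x {..<n}"
  have r: "feasible c \<phi> E n (?r x) e \<longleftrightarrow> feasible c \<phi> E n x e" for x
    by (rule feasible_cong) auto
  have "{x. feasible c \<phi> E n x e} = (\<Union>a\<in>range ?r \<inter> {a. feasible c \<phi> E n a e}. {x. ?r x = a})"
  proof (intro equalityI subsetI)
    fix x assume "x \<in> {x. feasible c \<phi> E n x e}"
    then have "feasible c \<phi> E n (?r x) e"
      by (simp only: r mem_Collect_eq)
    then show "x \<in> (\<Union>a\<in>range ?r \<inter> {a. feasible c \<phi> E n a e}. {x. ?r x = a})"
      by blast
  next
    fix x assume "x \<in> (\<Union>a\<in>range ?r \<inter> {a. feasible c \<phi> E n a e}. {x. ?r x = a})"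
    then obtain a where "a \<in> range ?r \<inter> {a. feasible c \<phi> E n a e}" "x \<in> {x. ?r x = a}"
      by (rule UN_E)
    then show "x \<in> {x. feasible c \<phi> E n x e}"
      by (simp only: Int_iff mem_Collect_eq flip: r[of x])
  qed
  also have "\<dots> \<in> sets path_space"
    by (rule sets.finite_UN) (auto intro: finite_prefixes)
  finally show ?thesis .
qed

lemma feasible_inf_event: "{x :: nat \<Rightarrow> 'x::finite. feasible_inf c \<phi> E x e} \<in> sets path_space"
proof -
  have "{x :: nat \<Rightarrow> 'x. feasible_inf c \<phi> E x e} = (\<Inter>n. {x. feasible c \<phi> E n x e})"
    by (auto simp: feasible_inf_iff)
  also have "\<dots> \<in> sets path_space"
    by (rule sets.countable_INT) (use feasible_event in auto)
  finally show ?thesis .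
qed

lemma prefix_simple_distributed:
  fixes P :: "(nat \<Rightarrow> 'x::finite) measure"
  assumes "prob_space P" and sets: "sets P = sets path_space"
  shows "simple_distributed P (\<lambda>x. restrict x {..<n}) (\<lambda>a. measure P {x. restrict x {..<n} = a})"
proof -
  interpret prob_space P by fact
  have sp: "space P = UNIV"
    using sets_eq_imp_space_eq[OF sets] by simp
  have v: "(\<lambda>x. restrict x {..<n}) -` {a} = {x :: nat \<Rightarrow> 'x. restrict x {..<n} = a}" for a
    by auto
  show ?thesis
    by (rule simple_distributedI) (auto simp: simple_function_def sp finite_prefixes v sets prefix_eq_event)
qed

section \<open>Entropy bounds from the support size and from the largest atom\<close>

lemma log_of_nat_mono:
  assumes "1 < b" "m \<le> n"
  shows "log b (real m) \<le> log b (real n)"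
proof (cases "m = 0")
  case True
  \<comment> \<open>The default value at 0 keeps the inequality true there, as logarithms of
    positive integers are nonnegative.\<close>
  have "log b 0 = 0" by (simp add: log_def)
  then show ?thesis
    using True assms by (cases "n = 0") auto
qed (use assms in auto)

text \<open>Entropy is at most the logarithm of the number of values taken with positive
  probability. An event of positive probability meets the almost sure set of feasible sequences, so
  each such prefix begins one of them.\<close>

lemma block_entropy_le_log_feasible_words:
  fixes P :: "(nat \<Rightarrow> 'x::finite) measure"
  assumes P: "prob_space P" and sets: "sets P = sets path_space"
    and ae: "AE x in P. feasible_inf c \<phi> E x e"
  shows "block_entropy P n \<le> log 2 (card (feasible_words c \<phi> E e n))"
proof -
  interpret information_space P 2
    using P by (simp add: information_space_def information_space_axioms_def)
  have sp: "space P = UNIV"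
    using sets_eq_imp_space_eq[OF sets] by simp
  let ?r = "\<lambda>x :: nat \<Rightarrow> 'x. restrict x {..<n}"
  let ?S = "?r ` space P \<inter> {a. measure P {x. ?r x = a} \<noteq> 0}"
  have "block_entropy P n \<le> log 2 (card ?S)"
    unfolding block_entropy_def
    by (rule entropy_le_card_not_0[OF prefix_simple_distributed[OF P sets]])
  moreover have "?S \<subseteq> feasible_words c \<phi> E e n"
  proof
    fix a assume a: "a \<in> ?S"
    have "\<exists>x. ?r x = a \<and> feasible_inf c \<phi> E x e"
    proof (rule ccontr)
      assume no: "\<nexists>x. ?r x = a \<and> feasible_inf c \<phi> E x e"
      have "AE x in P. x \<notin> {x. ?r x = a}"
        using ae by eventually_elim (use no in auto)
      then have "measure P {x. ?r x = a} = 0"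
        using prefix_eq_event[of n a] by (subst prob_eq_0) (auto simp: sets)
      with a show False by simp
    qed
    then obtain x where "?r x = a" "feasible c \<phi> E n x e"
      by (auto simp: feasible_inf_iff)
    moreover have "feasible c \<phi> E n (?r x) e \<longleftrightarrow> feasible c \<phi> E n x e"
      by (rule feasible_cong) auto
    ultimately show "a \<in> feasible_words c \<phi> E e n"
      by (auto simp: feasible_words_def PiE_def)
  qed
  then have "card ?S \<le> card (feasible_words c \<phi> E e n)"
    by (intro card_mono) auto
  then have "log 2 (card ?S) \<le> log 2 (card (feasible_words c \<phi> E e n))"
    by (intro log_of_nat_mono) auto
  ultimately show ?thesis by linarith
qed

text \<open>Shannon entropy dominates min-entropy: \<open>- log 2\<close> of every positive atom is
  at least \<open>log 2 K\<close>, and entropy is the average of these values.\<close>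

lemma block_entropy_ge_min_entropy:
  fixes P :: "(nat \<Rightarrow> 'x::finite) measure"
  assumes P: "prob_space P" and sets: "sets P = sets path_space"
    and atoms: "\<And>a. measure P {x. restrict x {..<n} = a} \<le> 1 / K" and K: "0 < K"
  shows "log 2 K \<le> block_entropy P n"
proof -
  interpret information_space P 2
    using P by (simp add: information_space_def information_space_axioms_def)
  let ?r = "\<lambda>x :: nat \<Rightarrow> 'x. restrict x {..<n}"
  let ?p = "\<lambda>a. measure P {x. ?r x = a}"
  note sd = prefix_simple_distributed[OF P sets, of n]
  have "log 2 K = (\<Sum>a\<in>?r ` space P. ?p a * log 2 K)"
    using simple_distributed_sum_space[OF sd] by (simp flip: sum_distrib_right)
  also have "\<dots> \<le> (\<Sum>a\<in>?r ` space P. - (?p a * log 2 (?p a)))"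
  proof (rule sum_mono)
    fix a
    show "?p a * log 2 K \<le> - (?p a * log 2 (?p a))"
    proof (cases "?p a = 0")
      case False
      then have p: "0 < ?p a" by (simp add: zero_less_measure_iff)
      then have "log 2 (?p a) \<le> log 2 (1 / K)"
        using atoms[of a] K by simp
      also have "\<dots> = - log 2 K"
        using K by (simp add: log_divide)
      finally have "log 2 K \<le> - log 2 (?p a)" by simp
      then have "?p a * log 2 K \<le> ?p a * (- log 2 (?p a))"
        using p by (intro mult_left_mono) auto
      then show ?thesis by simp
    qed simp
  qed
  also have "\<dots> = block_entropy P n"
    unfolding block_entropy_def entropy_simple_distributed[OF sd] by (simp add: sum_negf)
  finally show ?thesis .
qed

section \<open>Sequences assembled from independent uniform blocks\<close>

definition unroll :: "nat \<Rightarrow> nat \<Rightarrow> 'a \<Rightarrow> (nat \<Rightarrow> nat \<Rightarrow> 'a) \<Rightarrow> nat \<Rightarrow> 'a" where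
  "unroll p m d \<omega> t = (if t mod p < m then \<omega> (t div p) (t mod p) else d)"

text \<open>\<open>unroll\<close> cuts time into periods of length \<open>p\<close>: the first
  \<open>m\<close> offsets of period \<open>j\<close> copy \<open>\<omega> j\<close>, the others
  hold the filler \<open>d\<close>. Here the blocks are independent and uniform on \<open>W\<close>;
  a constant \<open>\<omega>\<close> later gives the energy schedule.\<close>

definition iid_blocks :: "nat \<Rightarrow> nat \<Rightarrow> 'a \<Rightarrow> (nat \<Rightarrow> 'a) set \<Rightarrow> (nat \<Rightarrow> 'a) measure" where
  "iid_blocks p m d W =
     distr (Pi\<^sub>M UNIV (\<lambda>_ :: nat. uniform_count_measure W)) path_space (unroll p m d)"

lemma unroll_shift:
  assumes "0 < p"
  shows "unroll p m d \<omega> (j * p + i) = unroll p m d (\<lambda>k. \<omega> (j + k)) i"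
  using assms by (simp add: unroll_def)

lemma sets_iid_blocks [simp]: "sets (iid_blocks p m d W) = sets path_space"
  by (simp add: iid_blocks_def)

lemma unroll_measurable [measurable]:
  "unroll p m d \<in> measurable (Pi\<^sub>M UNIV (\<lambda>_ :: nat. uniform_count_measure W)) path_space"
  unfolding path_space_def
proof (rule measurable_PiM_single')
  fix t
  have f: "(\<lambda>\<omega>. \<omega> (t div p)) \<in> measurable (Pi\<^sub>M UNIV (\<lambda>_ :: nat. uniform_count_measure W)) (uniform_count_measure W)"
    by (rule measurable_component_singleton) simp
  have g: "(\<lambda>w. w (t mod p)) \<in> measurable (uniform_count_measure W) (count_space UNIV)"
    by (auto simp: measurable_def sets_uniform_count_measure space_uniform_count_measure)
  show "(\<lambda>\<omega>. unroll p m d \<omega> t) \<in>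
      measurable (Pi\<^sub>M UNIV (\<lambda>_ :: nat. uniform_count_measure W)) (count_space UNIV)"
    unfolding unroll_def by (cases "t mod p < m") (auto intro: measurable_compose[OF f g])
qed (auto simp: space_PiM)

lemma prob_space_iid_blocks:
  assumes "finite W" "W \<noteq> {}"
  shows "prob_space (iid_blocks p m d W)"
  unfolding iid_blocks_def
  by (intro prob_space.prob_space_distr unroll_measurable prob_space_PiM
        prob_space_uniform_count_measure assms)

text \<open>A prefix of length \<open>n\<close> covers \<open>n div p\<close> complete periods and
  determines the word in each. These words are independent, and each takes a prescribed value with
  probability at most \<open>1 / card W\<close>.\<close>

lemma iid_blocks_atom_le:
  assumes W: "finite W" "W \<noteq> {}" "W \<subseteq> extensional {..<m}" and m: "m \<le> p"
  shows "measure (iid_blocks p m d W) {x. restrict x {..<n} = a} \<le> 1 / real (card W) ^ (n div p)"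
proof -
  let ?U = "\<lambda>_ :: nat. uniform_count_measure W"
  interpret U: product_prob_space ?U UNIV
    using W by (simp add: product_prob_space_def product_prob_space_axioms_def
        product_sigma_finite_def prob_space_uniform_count_measure prob_space_imp_sigma_finite)
  define k where "k = n div p"
  \<comment> \<open>The word that the prefix \<open>a\<close> forces in period \<open>j\<close>. It
    may lie outside \<open>W\<close>; intersecting with \<open>W\<close> keeps the event below
    measurable.\<close>
  define w where "w j = restrict (\<lambda>i. a (j * p + i)) {..<m}" for j
  let ?C = "{\<omega> \<in> space (Pi\<^sub>M UNIV ?U). \<forall>j\<in>{..<k}. \<omega> j \<in> {w j} \<inter> W}"
  have cp: "real (card W) > 0"
    using W by (simp add: card_gt_0_iff)
  have "measure (iid_blocks p m d W) {x. restrict x {..<n} = a} =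
      measure (Pi\<^sub>M UNIV ?U) (unroll p m d -` {x. restrict x {..<n} = a} \<inter> space (Pi\<^sub>M UNIV ?U))"
    unfolding iid_blocks_def by (intro measure_distr unroll_measurable prefix_eq_event)
  also have "\<dots> \<le> measure (Pi\<^sub>M UNIV ?U) ?C"
  proof (rule U.P.finite_measure_mono)
    have [measurable]: "{w j} \<inter> W \<in> sets (uniform_count_measure W)" for j
      by (auto simp: sets_uniform_count_measure)
    show "?C \<in> sets (Pi\<^sub>M UNIV ?U)"
      by measurable
    show "unroll p m d -` {x. restrict x {..<n} = a} \<inter> space (Pi\<^sub>M UNIV ?U) \<subseteq> ?C"
    proof safe
      fix \<omega> j
      assume \<omega>: "\<omega> \<in> space (Pi\<^sub>M UNIV ?U)" and a: "a = restrict (unroll p m d \<omega>) {..<n}" and j: "j < k"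
      have \<omega>W: "\<omega> j \<in> W"
        using \<omega> by (auto simp: space_PiM space_uniform_count_measure)
      then show "\<omega> j \<in> W" .
      show "\<omega> j = w j"
      proof
        fix i
        show "\<omega> j i = w j i"
        proof (cases "i < m")
          case True
          have "j * p + i < Suc j * p"
            using True m by simp
          also have "\<dots> \<le> k * p"
            using j by (intro mult_le_mono1) simp
          also have "\<dots> \<le> n"
            by (simp add: k_def)
          finally have "j * p + i < n" .
          then show ?thesis
            using True m by (simp add: w_def a unroll_def)
        next
          case False
          then show ?thesis
            using \<omega>W W(3) by (auto simp: w_def extensional_def)
        qed
      qed
    qed
  qed
  also have "\<dots> = (\<Prod>j<k. measure (uniform_count_measure W) ({w j} \<inter> W))"
  proof -
    have "emeasure (Pi\<^sub>M UNIV ?U) ?C = (\<Prod>j<k. emeasure (uniform_count_measure W) ({w j} \<inter> W))"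
      by (rule U.emeasure_PiM_Collect) (auto simp: sets_uniform_count_measure)
    then show ?thesis
      by (simp add: U.P.emeasure_eq_measure U.M.emeasure_eq_measure prod_ennreal prod_nonneg)
  qed
  also have "\<dots> \<le> (\<Prod>j<k. 1 / real (card W))"
  proof (rule prod_mono, safe)
    fix j
    have "card ({w j} \<inter> W) \<le> card {w j}"
      by (rule card_mono) auto
    then show "measure (uniform_count_measure W) ({w j} \<inter> W) \<le> 1 / real (card W)"
      using W(1) cp by (simp add: measure_uniform_count_measure divide_right_mono)
  qed auto
  also have "\<dots> = 1 / real (card W) ^ k"
    by (simp add: power_one_over)
  finally show ?thesis
    by (simp add: k_def)
qed

subsection \<open>Periodic schedules\<close>

lemma sum_lessThan_add:
  fixes f :: "nat \<Rightarrow> 'a::comm_monoid_add"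
  shows "(\<Sum>t<a + p. f t) = (\<Sum>t<a. f t) + (\<Sum>i<p. f (a + i))"
  by (induction p) (simp_all add: add.assoc)

context energy_harvesting
begin

text \<open>While free symbols are sent, the level rises by \<open>\<epsilon>\<close> per step until
  capped at \<open>c\<close>. The bound assumes only a nonnegative starting level, so a fixed number
  of steps fills the battery whatever word was sent.\<close>

lemma recharge:
  assumes m: "feasible c \<phi> E m x e" and \<epsilon>: "\<epsilon> \<in> E"
    and rest: "\<And>i. i < K \<Longrightarrow> x (m + i) = x0 \<and> e (m + i) = \<epsilon>" and i: "i \<le> K"
  shows "feasible c \<phi> E (m + i) x e \<and> min c (real i * \<epsilon>) \<le> battery c \<phi> x e (m + i)"
  using i
proof (induction i)
  case 0
  then show ?case using m battery_nonneg[OF m] by simp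
next
  case (Suc i)
  then have f: "feasible c \<phi> E (m + i) x e" and b: "min c (real i * \<epsilon>) \<le> battery c \<phi> x e (m + i)"
    by auto
  have "x (m + i) = x0" "e (m + i) = \<epsilon>"
    using rest[of i] Suc.prems by auto
  moreover have "0 \<le> \<epsilon>"
    using E_nonneg \<epsilon> by auto
  ultimately show ?case
    using f b battery_nonneg[OF f] zero_cost \<epsilon> capacity_nonneg
    by (auto simp: feasible_Suc algebra_simps min_def split: if_splits)
qed

text \<open>The word is replayed under the arrivals it was feasible for; then \<open>K\<close>
  recharging steps give at least \<open>min c (K * \<epsilon>) = c\<close>, which is also the
  largest possible level.\<close>

lemma block_feasible:
  assumes w: "w 0 \<in> W e m" and m: "0 < m" and \<epsilon>: "\<epsilon> \<in> E" and K: "c \<le> real K * \<epsilon>"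
  defines "p \<equiv> m + K"
  shows "feasible c \<phi> E p (unroll p m x0 w) (unroll p m \<epsilon> (\<lambda>_. e))"
    and "battery c \<phi> (unroll p m x0 w) (unroll p m \<epsilon> (\<lambda>_. e)) p = c"
proof -
  have "feasible c \<phi> E m (unroll p m x0 w) (unroll p m \<epsilon> (\<lambda>_. e)) \<longleftrightarrow> feasible c \<phi> E m (w 0) e"
    by (rule feasible_cong) (simp_all add: unroll_def p_def)
  then have "feasible c \<phi> E m (unroll p m x0 w) (unroll p m \<epsilon> (\<lambda>_. e))"
    using w by (simp add: feasible_words_def)
  from recharge[OF this \<epsilon>, of K K]
  have "feasible c \<phi> E p (unroll p m x0 w) (unroll p m \<epsilon> (\<lambda>_. e)) \<and>
      c \<le> battery c \<phi> (unroll p m x0 w) (unroll p m \<epsilon> (\<lambda>_. e)) p"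
    using K by (simp add: p_def unroll_def min_absorb1)
  then show "feasible c \<phi> E p (unroll p m x0 w) (unroll p m \<epsilon> (\<lambda>_. e))"
    and "battery c \<phi> (unroll p m x0 w) (unroll p m \<epsilon> (\<lambda>_. e)) p = c"
    using battery_le by (auto intro: antisym)
qed

text \<open>Each period starts with a full battery, so the one-period result applies to the shifted
  blocks and is glued on by the restart lemmas.\<close>

lemma blocks_feasible:
  assumes w: "\<And>j. w j \<in> W e m" and m: "0 < m" and \<epsilon>: "\<epsilon> \<in> E" and K: "c \<le> real K * \<epsilon>"
  defines "p \<equiv> m + K"
  shows "feasible c \<phi> E (j * p) (unroll p m x0 w) (unroll p m \<epsilon> (\<lambda>_. e)) \<and>
    battery c \<phi> (unroll p m x0 w) (unroll p m \<epsilon> (\<lambda>_. e)) (j * p) = c"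
proof (induction j)
  case 0
  then show ?case by (simp add: feasible_def)
next
  case (Suc j)
  have p: "0 < p" using m by (simp add: p_def)
  have "feasible c \<phi> E p (unroll p m x0 (\<lambda>k. w (j + k))) (unroll p m \<epsilon> (\<lambda>_. e))"
    "battery c \<phi> (unroll p m x0 (\<lambda>k. w (j + k))) (unroll p m \<epsilon> (\<lambda>_. e)) p = c"
    using block_feasible[of "\<lambda>k. w (j + k)" e m \<epsilon> K] w m \<epsilon> K by (auto simp: p_def)
  moreover have "(\<lambda>i. unroll p m x0 w (j * p + i)) = unroll p m x0 (\<lambda>k. w (j + k))"
    "(\<lambda>i. unroll p m \<epsilon> (\<lambda>_. e) (j * p + i)) = unroll p m \<epsilon> (\<lambda>_. e)"
    by (auto simp: unroll_shift[OF p])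
  ultimately show ?case
    using feasible_add[of c \<phi> E "j * p" "unroll p m x0 w" "unroll p m \<epsilon> (\<lambda>_. e)" p]
      battery_add[of c \<phi> "unroll p m x0 w" "unroll p m \<epsilon> (\<lambda>_. e)" "j * p" p] Suc.IH
    by (simp add: add.commute)
qed

lemma iid_blocks_admissible:
  assumes e: "e \<in> energy_seqs E" and m: "0 < m" and \<epsilon>: "\<epsilon> \<in> E" and K: "c \<le> real K * \<epsilon>"
  defines "p \<equiv> m + K"
  shows "(iid_blocks p m x0 (W e m), unroll p m \<epsilon> (\<lambda>_. e)) \<in> admissible c \<phi> E"
proof -
  have "AE x in iid_blocks p m x0 (W e m). feasible_inf c \<phi> E x (unroll p m \<epsilon> (\<lambda>_. e))"
    unfolding iid_blocks_def
  proof (subst AE_distr_iff)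
    show "{x \<in> space path_space. feasible_inf c \<phi> E x (unroll p m \<epsilon> (\<lambda>_. e))} \<in> sets path_space"
      using feasible_inf_event by simp
    show "AE \<omega> in Pi\<^sub>M UNIV (\<lambda>_. uniform_count_measure (W e m)).
        feasible_inf c \<phi> E (unroll p m x0 \<omega>) (unroll p m \<epsilon> (\<lambda>_. e))"
    proof (rule AE_I2)
      fix \<omega> assume "\<omega> \<in> space (Pi\<^sub>M UNIV (\<lambda>_ :: nat. uniform_count_measure (W e m)))"
      then have "\<omega> j \<in> W e m" for j
        by (auto simp: space_PiM space_uniform_count_measure)
      then have "feasible c \<phi> E (n * p) (unroll p m x0 \<omega>) (unroll p m \<epsilon> (\<lambda>_. e))" for n
        using blocks_feasible[of \<omega> e m \<epsilon> K n] m \<epsilon> K by (simp add: p_def)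
      \<comment> \<open>Every outcome is feasible, not just almost every one: a horizon
        \<open>n\<close> is contained in \<open>n\<close> whole periods.\<close>
      moreover have "n \<le> n * p" for n
        using m by (simp add: p_def)
      ultimately show "feasible_inf c \<phi> E (unroll p m x0 \<omega>) (unroll p m \<epsilon> (\<lambda>_. e))"
        unfolding feasible_inf_iff using feasible_mono by blast
    qed
  qed (rule unroll_measurable)
  moreover have "prob_space (iid_blocks p m x0 (W e m))"
    using feasible_words_nonempty[OF e] by (intro prob_space_iid_blocks) auto
  moreover have "unroll p m \<epsilon> (\<lambda>_. e) \<in> energy_seqs E"
    using e \<epsilon> by (auto simp: energy_seqs_def unroll_def)
  ultimately show ?thesis
    by (simp add: admissible_def)
qed

text \<open>Rounding the horizon up to whole periods can only add energy, because arrivals are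
  nonnegative.\<close>

lemma sum_unroll_le:
  fixes K :: nat
  assumes e: "e \<in> energy_seqs E" and m: "0 < m" and \<epsilon>: "\<epsilon> \<in> E"
  defines "p \<equiv> m + K"
  shows "(\<Sum>t<n. unroll p m \<epsilon> (\<lambda>_. e) t) \<le> real (n div p + 1) * ((\<Sum>t<m. e t) + real K * \<epsilon>)"
proof -
  let ?e = "unroll p m \<epsilon> (\<lambda>_. e)"
  have p: "0 < p" using m by (simp add: p_def)
  have nonneg: "0 \<le> ?e t" for t
    using e \<epsilon> E_nonneg by (auto simp: energy_seqs_def unroll_def Pi_iff)
  have "(\<Sum>t<p. ?e t) = (\<Sum>t<m. ?e t) + (\<Sum>i<K. ?e (m + i))"
    unfolding p_def by (rule sum_lessThan_add)
  also have "\<dots> = (\<Sum>t<m. e t) + real K * \<epsilon>"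
    by (simp add: unroll_def p_def)
  finally have block: "(\<Sum>t<p. ?e t) = (\<Sum>t<m. e t) + real K * \<epsilon>" .
  have "(\<Sum>t<n. ?e t) \<le> (\<Sum>t<(n div p + 1) * p. ?e t)"
  proof (rule sum_mono2)
    show "{..<n} \<subseteq> {..<(n div p + 1) * p}"
      using dividend_less_div_times[OF p, of n] by auto
  qed (auto intro: nonneg)
  also have "(\<Sum>t<k * p. ?e t) = real k * ((\<Sum>t<m. e t) + real K * \<epsilon>)" for k
  proof (induction k)
    case (Suc k)
    have "(\<Sum>t<Suc k * p. ?e t) = (\<Sum>t<k * p. ?e t) + (\<Sum>i<p. ?e (k * p + i))"
      by (subst sum_lessThan_add[symmetric]) (simp add: add.commute)
    also have "(\<Sum>i<p. ?e (k * p + i)) = (\<Sum>t<m. e t) + real K * \<epsilon>"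
      using block by (simp only: unroll_shift[OF p])
    finally show ?case
      using Suc by (simp add: algebra_simps)
  qed simp
  finally show ?thesis .
qed

section \<open>Rates achieved by block schemes, and the resulting value\<close>

lemma J_empty_ge_block_rate:
  assumes e: "e \<in> energy_seqs E" and m: "0 < m" and \<epsilon>: "\<epsilon> \<in> E" and K: "c \<le> real K * \<epsilon>"
    and \<rho>: "0 \<le> \<rho>"
  shows "ereal ((log 2 (total B (N e m)) - \<rho> * ((\<Sum>t<m. e t) + real K * \<epsilon>)) / real (m + K))
    \<le> J_empty c \<phi> E \<rho>"
proof -
  define p where "p = m + K"
  define P where "P = iid_blocks p m x0 (W e m)"
  define e' where "e' = unroll p m \<epsilon> (\<lambda>_. e)"
  define L where "L = log 2 (total B (N e m))"
  define S where "S = (\<Sum>t<m. e t) + real K * \<epsilon>"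
  \<comment> \<open>Net reward of one period: entropy is gained in the first \<open>m\<close> steps
    only, energy is paid for in all \<open>m + K\<close>.\<close>
  define R where "R = L - \<rho> * S"
  have p: "0 < p" using m by (simp add: p_def)
  have adm: "(P, e') \<in> admissible c \<phi> E"
    using iid_blocks_admissible[OF e m \<epsilon> K] by (simp add: P_def e'_def p_def)
  have card: "0 < card (W e m)"
    using feasible_words_nonempty[OF e] by (simp add: card_gt_0_iff)
  have ent: "real (n div p) * L \<le> block_entropy P n" for n
  proof -
    have "log 2 (real (card (W e m)) ^ (n div p)) \<le> block_entropy P n"
    proof (rule block_entropy_ge_min_entropy)
      show "prob_space P" "sets P = sets path_space"
        using adm by (auto simp: admissible_def)
      show "measure P {x. restrict x {..<n} = a} \<le> 1 / real (card (W e m)) ^ (n div p)" for a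
        unfolding P_def
        by (rule iid_blocks_atom_le[OF finite_feasible_words feasible_words_nonempty[OF e]])
          (auto simp: feasible_words_def PiE_def p_def)
    qed (use card in simp)
    then show ?thesis
      using card by (simp add: L_def total_num_words log_nat_power)
  qed
  \<comment> \<open>Entropy is credited for \<open>n div p\<close> periods, energy is charged for
    one more. Replacing \<open>n div p\<close> by \<open>n / p\<close> costs at most
    \<open>\<bar>R\<bar>\<close>, as \<open>R\<close> may have either sign; the additional period
    costs \<open>\<rho> * S\<close>. Both vanish after division by \<open>n\<close>.\<close>
  have low: "R / real p - (\<bar>R\<bar> + \<rho> * S) / real n
      \<le> 1 / real n * (block_entropy P n - \<rho> * (\<Sum>t<n. e' t))" if n: "0 < n" for n
  proof -
    define k where "k = n div p"
    have "real n * R / real p - real k * R = real (n mod p) / real p * R"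
    proof -
      have "real n = real k * real p + real (n mod p)"
        unfolding k_def by (metis div_mult_mod_eq of_nat_add of_nat_mult)
      then show ?thesis
        using p by (simp add: field_simps)
    qed
    also have "\<dots> \<le> real (n mod p) / real p * \<bar>R\<bar>"
      by (intro mult_left_mono) auto
    also have "\<dots> \<le> 1 * \<bar>R\<bar>"
      using mod_less_divisor[OF p, of n] p by (intro mult_right_mono) auto
    finally have "real n * R / real p - \<bar>R\<bar> - \<rho> * S \<le> real k * L - \<rho> * (real (k + 1) * S)"
      by (simp add: R_def algebra_simps)
    also have "\<dots> \<le> block_entropy P n - \<rho> * (\<Sum>t<n. e' t)"
      using ent[of n] sum_unroll_le[OF e m \<epsilon>, of K n] \<rho>
      by (intro diff_mono mult_left_mono) (auto simp: k_def e'_def p_def S_def)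
    finally have "(real n * R / real p - \<bar>R\<bar> - \<rho> * S) / real n
        \<le> (block_entropy P n - \<rho> * (\<Sum>t<n. e' t)) / real n"
      by (rule divide_right_mono) simp
    moreover have "(real n * R / real p - \<bar>R\<bar> - \<rho> * S) / real n = R / real p - (\<bar>R\<bar> + \<rho> * S) / real n"
      using n p by (simp add: field_simps)
    ultimately show ?thesis by simp
  qed
  have "(\<lambda>n. R / real p - (\<bar>R\<bar> + \<rho> * S) / real n) \<longlonglongrightarrow> R / real p - 0"
    by (intro tendsto_diff tendsto_const lim_const_over_n)
  then have "(\<lambda>n. ereal (R / real p - (\<bar>R\<bar> + \<rho> * S) / real n)) \<longlonglongrightarrow> ereal (R / real p)"
    by simp
  then have "ereal (R / real p) = liminf (\<lambda>n. ereal (R / real p - (\<bar>R\<bar> + \<rho> * S) / real n))"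
    using lim_imp_Liminf[OF sequentially_bot] by metis
  also have "\<dots> \<le> liminf (\<lambda>n. ereal (1 / real n * (block_entropy P n - \<rho> * (\<Sum>t<n. e' t))))"
  proof (rule Liminf_mono)
    show "\<forall>\<^sub>F n in sequentially. ereal (R / real p - (\<bar>R\<bar> + \<rho> * S) / real n)
        \<le> ereal (1 / real n * (block_entropy P n - \<rho> * (\<Sum>t<n. e' t)))"
      using eventually_gt_at_top[of 0] by eventually_elim (simp only: ereal_less_eq low)
  qed
  also have "\<dots> \<le> J_empty c \<phi> E \<rho>"
    unfolding J_empty_def using adm by (rule SUP_upper2) simp
  finally show ?thesis
    by (simp add: R_def L_def S_def p_def)
qed

text \<open>A real \<open>r\<close> below the limit inferior is exceeded by the averages over
  \<open>m\<close> steps for all large \<open>m\<close>. Blocks of such length achieve at least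
  \<open>(r * m - C) / (m + K)\<close>, which tends to \<open>r\<close> as \<open>K\<close> and
  \<open>C\<close> do not depend on \<open>m\<close>.\<close>

lemma J_empty_ge_liminf:
  assumes e: "e \<in> energy_seqs E" and \<rho>: "0 \<le> \<rho>"
  shows "liminf (\<lambda>n. ereal (1 / real n * (log 2 (total B (N e n)) - \<rho> * (\<Sum>t<n. e t))))
    \<le> J_empty c \<phi> E \<rho>" (is "?L \<le> _")
proof (rule dense_le)
  fix y assume "y < ?L"
  then obtain r where r: "y < ereal r" "ereal r < ?L"
    using ereal_dense2 by blast
  obtain \<epsilon> where \<epsilon>: "\<epsilon> \<in> E" "0 < \<epsilon>"
    using pos_arrival by blast
  \<comment> \<open>\<open>K\<close> arrivals of size \<open>\<epsilon>\<close> suffice to fill an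
    empty battery; \<open>C\<close> below is the price of that energy.\<close>
  obtain K :: nat where "c / \<epsilon> \<le> real K"
    using real_arch_simple by blast
  then have K: "c \<le> real K * \<epsilon>"
    using \<epsilon> by (simp add: field_simps)
  define C where "C = \<rho> * real K * \<epsilon>"
  have "((\<lambda>m. r - (C + r * real K) / real (m + K)) \<longlongrightarrow> r - 0) sequentially"
    using LIMSEQ_ignore_initial_segment[OF lim_const_over_n[of "C + r * real K"], of K]
    by (intro tendsto_diff tendsto_const)
  then have lim: "(\<lambda>m. ereal (r - (C + r * real K) / real (m + K))) \<longlonglongrightarrow> ereal r"
    by simp
  have "ereal r \<le> J_empty c \<phi> E \<rho>"
  proof (rule tendsto_upperbound[OF lim])
    show "\<forall>\<^sub>F m in sequentially. ereal (r - (C + r * real K) / real (m + K)) \<le> J_empty c \<phi> E \<rho>"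
      using less_LiminfD[OF r(2)] eventually_gt_at_top[of 0]
    proof eventually_elim
      case (elim m)
      then have "r * real m < log 2 (total B (N e m)) - \<rho> * (\<Sum>t<m. e t)"
        by (simp add: field_simps)
      then have "(r * real m - C) / real (m + K)
          \<le> (log 2 (total B (N e m)) - \<rho> * ((\<Sum>t<m. e t) + real K * \<epsilon>)) / real (m + K)"
        by (intro divide_right_mono) (auto simp: C_def algebra_simps)
      also have "ereal \<dots> \<le> J_empty c \<phi> E \<rho>"
        by (rule J_empty_ge_block_rate) (use e elim \<epsilon> K \<rho> in auto)
      finally have "ereal ((r * real m - C) / real (m + K)) \<le> J_empty c \<phi> E \<rho>"
        by simp
      moreover have "(r * real m - C) / real (m + K) = r - (C + r * real K) / real (m + K)"
        using elim by (simp add: field_simps)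
      ultimately show ?case by simp
    qed
  qed simp
  with r(1) show "y \<le> J_empty c \<phi> E \<rho>" by simp
qed

text \<open>For an admissible pair the entropy never exceeds the logarithm of the word count for the
  same \<open>e\<close>, which gives one direction. The other comes from block schemes built from
  \<open>e\<close>, whose energy sequences may differ from \<open>e\<close>.\<close>

lemma J_empty_eq:
  assumes \<rho>: "0 \<le> \<rho>"
  shows "J_empty c \<phi> E \<rho> =
    (SUP e \<in> energy_seqs E.
       liminf (\<lambda>n. ereal (1 / real n * (log 2 (total B (N e n)) - \<rho> * (\<Sum>t<n. e t)))))"
proof (rule antisym)
  show "J_empty c \<phi> E \<rho> \<le> (SUP e \<in> energy_seqs E.
       liminf (\<lambda>n. ereal (1 / real n * (log 2 (total B (N e n)) - \<rho> * (\<Sum>t<n. e t)))))"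
    unfolding J_empty_def
  proof (rule SUP_least, clarify)
    fix P :: "(nat \<Rightarrow> 'x) measure" and e
    assume "(P, e) \<in> admissible c \<phi> E"
    then have e: "e \<in> energy_seqs E" and "block_entropy P n \<le> log 2 (total B (N e n))" for n
      by (auto simp: admissible_def total_num_words intro: block_entropy_le_log_feasible_words)
    then show "liminf (\<lambda>n. ereal (1 / real n * (block_entropy P n - \<rho> * (\<Sum>t<n. e t)))) \<le>
      (SUP e \<in> energy_seqs E.
         liminf (\<lambda>n. ereal (1 / real n * (log 2 (total B (N e n)) - \<rho> * (\<Sum>t<n. e t)))))"
      \<comment> \<open>At \<open>n = 0\<close> both sides are 0, by the convention
        \<open>1 / 0 = 0\<close>.\<close>
      by (intro SUP_upper2[OF e] Liminf_mono always_eventually allI)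
        (simp add: divide_right_mono)
  qed
qed (intro SUP_least J_empty_ge_liminf \<rho>)

end

theorem mainTheorem6:
  fixes \<phi> :: "'x::finite \<Rightarrow> real" and x0 :: 'x
    and E :: "real set" and c \<rho> :: real
    and A :: "real \<Rightarrow> real \<Rightarrow> real \<Rightarrow> real"
  defines "B \<equiv> levels c \<phi> E"
  defines "N \<equiv> num_words c \<phi> E"
  assumes phi: "\<forall>x. 0 \<le> \<phi> x \<and> \<phi> x \<le> c" and zero: "\<phi> x0 = 0"
    and E: "finite E" "E \<subseteq> {0..c}" "\<exists>e\<in>E. 0 < e"
    and finB: "finite B"
    and rho: "0 \<le> \<rho>"
    and A: "A = multi_adjacency c \<phi> E \<or> (inj \<phi> \<and> A = adjacency c \<phi> E)"
  shows
    "J_empty c \<phi> E \<rho> =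
       (SUP e \<in> energy_seqs E.
          liminf (\<lambda>n. ereal (1 / real n * (log 2 (total B (N e n)) - \<rho> * (\<Sum>t<n. e t)))))
     \<and> (\<forall>e \<in> energy_seqs E. N e 0 = unit_mass c \<and>
          (\<forall>t. N e (Suc t) = vec_mat B (N e t) (A (e t))))
     \<and> unit_mass c \<in> simplex_vectors B
     \<and> (\<forall>s \<in> simplex_vectors B. \<forall>e \<in> E.
          0 < total B (vec_mat B s (A e)) \<and> transition B A s e \<in> simplex_vectors B)
     \<and> (\<forall>e \<in> energy_seqs E. \<forall>t.
          0 < total B (N e t) \<and>
          dmdp_state (transition B A) (unit_mass c) e t = (\<lambda>b. N e t b / total B (N e t)))
     \<and> J_empty c \<phi> E \<rho> =
          dmdp_optimal_reward E (transition B A) (reward B A \<rho>) (unit_mass c)"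
proof -
  interpret energy_harvesting \<phi> x0 E c
    using phi zero E finB by unfold_locales (auto simp: B_def)
  \<comment> \<open>Injective costs make the 0/1 matrix equal to the edge-count matrix, so both
    alternatives for \<open>A\<close> reduce to one.\<close>
  have A_eq: "A = multi_adjacency c \<phi> E"
    using A adjacency_inj by auto
  have "0 < total B (vec_mat B s (A e))" if "s \<in> simplex_vectors B" "e \<in> E" for s e
    using total_vec_mat_ge that unfolding A_eq B_def by fastforce
  then show ?thesis
    unfolding A_eq B_def N_def
    using J_empty_eq[OF rho] num_words_0 num_words_Suc unit_mass_simplex transition_simplex
      total_num_words_pos dmdp_state_eq dmdp_optimal_reward_eq
    by simp
qed

end
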